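(* For every positive integer $L$, $$\sum_{n\ge 0}a_2(L,n)q^n=\frac{1}{(q;q^2)_L}\left(q^2+q^3\frac{1-q^{2L-2}}{1-q^2}+q^6\frac{1-q^{4L-4}}{1-q^4}\right).$$
   Context: A partition of $n$ is a non-increasing finite sequence of positive integers summing to $n$ (the empty partition is the unique partition of $0$). Its Young diagram has $\lambda_i$ left-justified cells in row $i$; with $\lambda'_j$ the number of cells in column $j$, the hook length of cell $(i,j)$ is $h(i,j)=\lambda_i+\lambda'_j-i-j+1$. For a positive integer $L$, $a_2(L,n)$ is the total number of cells of hook length $2$, summed over all partitions of $n$ into odd parts with largest part at most $2L-1$. Here $(a;q)_L=\prod_{k=0}^{L-1}(1-aq^k)$, and the identity is one of formal power series in $q$. *)

theory Defs
  imports "HOL-Computational_Algebra.Formal_Power_Series"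
begin

definition is_partition :: "nat \<Rightarrow> nat list \<Rightarrow> bool" where
  "is_partition n xs \<longleftrightarrow>
     sorted_wrt (\<ge>) xs \<and> (\<forall>p\<in>set xs. 0 < p) \<and> sum_list xs = n"

text \<open>Rows and columns are numbered from 1, so row \<open>i\<close> of \<open>xs\<close> has \<open>xs ! (i - 1)\<close> cells.\<close>

definition row_length :: "nat list \<Rightarrow> nat \<Rightarrow> nat" where
  "row_length xs i = xs ! (i - 1)"

definition young_diagram :: "nat list \<Rightarrow> (nat \<times> nat) set" where
  "young_diagram xs =
     {(i, j). 1 \<le> i \<and> i \<le> length xs \<and> 1 \<le> j \<and> j \<le> row_length xs i}"

definition column_length :: "nat list \<Rightarrow> nat \<Rightarrow> nat" where
  "column_length xs j = card {i. (i, j) \<in> young_diagram xs}"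

text \<open>Integer-valued, to avoid truncated subtraction.\<close>

definition hook_length :: "nat list \<Rightarrow> nat \<times> nat \<Rightarrow> int" where
  "hook_length xs = (\<lambda>(i, j).
     int (row_length xs i) + int (column_length xs j) - int i - int j + 1)"

definition odd_partitions :: "nat \<Rightarrow> nat \<Rightarrow> nat list set" where
  "odd_partitions L n =
     {xs. is_partition n xs \<and> (\<forall>p\<in>set xs. odd p \<and> p \<le> 2 * L - 1)}"

definition a2 :: "nat \<Rightarrow> nat \<Rightarrow> nat" where
  "a2 L n = (\<Sum>xs\<in>odd_partitions L n. card {c \<in> young_diagram xs. hook_length xs c = 2})"

definition q_pochhammer :: "'a::comm_ring_1 \<Rightarrow> 'a \<Rightarrow> nat \<Rightarrow> 'a" where
  "q_pochhammer a q L = (\<Prod>k<L. 1 - a * q ^ k)"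

text \<open>The sum and the cardinalities in \<open>a2\<close> range over finite sets.\<close>

lemma finite_young_diagram: "finite (young_diagram xs)"
proof (rule finite_subset)
  show "young_diagram xs \<subseteq> (SIGMA i:{..length xs}. {..row_length xs i})"
    by (auto simp: young_diagram_def)
qed auto

lemma finite_odd_partitions: "finite (odd_partitions L n)"
proof (rule finite_subset)
  have "length xs \<le> sum_list xs" if "\<forall>p\<in>set xs. 0 < p" for xs :: "nat list"
    using that by (induction xs) auto
  then show "odd_partitions L n \<subseteq> {xs. set xs \<subseteq> {..n} \<and> length xs \<le> n}"
    by (auto simp: odd_partitions_def is_partition_def intro: member_le_sum_list)
  show "finite {xs. set xs \<subseteq> {..n} \<and> length xs \<le> n}"
    by (rule finite_lists_length_le) simp
qed

end

(* A cell of hook length 2 has either arm 0 and leg 1, or arm 1 and leg 0.  Cells of the first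
   kind correspond to the part sizes occurring at least twice; since distinct odd parts differ by
   at least 2, cells of the second kind correspond to the part sizes exceeding 1.  Adding m copies
   of p to a partition shows that the partitions containing p at least m times have generating
   function q^(m p) / (q; q^2)_L, so the total is obtained by summing q^(2 p) over all odd
   p < 2 L and q^p over those with p > 1: two geometric series. *)

theory Submission
  imports Defs "HOL-Library.Multiset"
begin

subsection \<open>Cells of hook length two\<close>

text \<open>For positive \<open>j\<close> this is the \<open>j\<close>-th part of the conjugate
  partition, defined from the list alone so that induction on the list applies.\<close>

definition parts_ge :: "nat list \<Rightarrow> nat \<Rightarrow> nat" where
  "parts_ge xs j = length (filter (\<lambda>x. j \<le> x) xs)"

lemma parts_ge_le_length: "parts_ge xs j \<le> length xs"
  by (simp add: parts_ge_def)

text \<open>In a non-increasing list the entries that are at least \<open>j\<close> form an initial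
  segment, and \<open>parts_ge xs j\<close> is its length. The index \<open>i\<close> counts from 0
  here.\<close>

lemma less_parts_ge_iff:
  assumes "sorted_wrt (\<ge>) xs" "i < length xs"
  shows "i < parts_ge xs j \<longleftrightarrow> j \<le> xs ! i"
  using assms
proof (induction xs arbitrary: i)
  case Nil
  then show ?case by simp
next
  case (Cons x xs)
  show ?case
  proof (cases "j \<le> x")
    case True
    with Cons show ?thesis by (cases i) (auto simp: parts_ge_def)
  next
    case False
    then have small: "\<forall>y\<in>set (x # xs). \<not> j \<le> y"
      using Cons.prems(1) by fastforce
    then have "parts_ge (x # xs) j = 0"
      by (auto simp: parts_ge_def filter_empty_conv)
    with small show ?thesis using nth_mem[OF Cons.prems(2)] by auto
  qed
qed

text \<open>Turns multiplicities into differences of consecutive column lengths: the entries that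
  are at least \<open>p\<close> but not at least \<open>Suc p\<close> are the copies of
  \<open>p\<close>.\<close>

lemma count_mset_eq_parts_ge: "count (mset xs) p + parts_ge xs (Suc p) = parts_ge xs p"
  by (induction xs) (auto simp: parts_ge_def)

lemma le_row_length_iff:
  assumes "sorted_wrt (\<ge>) xs" "1 \<le> i" "i \<le> length xs"
  shows "j \<le> row_length xs i \<longleftrightarrow> i \<le> parts_ge xs j"
  using assms less_parts_ge_iff[OF assms(1), of "i - 1" j]
  by (cases i) (auto simp: row_length_def Suc_le_eq)

lemma young_diagram_iff:
  assumes "sorted_wrt (\<ge>) xs"
  shows "(i, j) \<in> young_diagram xs \<longleftrightarrow> 1 \<le> i \<and> 1 \<le> j \<and> i \<le> parts_ge xs j"
  using le_row_length_iff[OF assms, of i j] parts_ge_le_length[of xs j]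
  by (auto simp: young_diagram_def)

lemma column_length_eq_parts_ge:
  assumes "sorted_wrt (\<ge>) xs" "1 \<le> j"
  shows "column_length xs j = parts_ge xs j"
proof -
  have "{i. (i, j) \<in> young_diagram xs} = {1..parts_ge xs j}"
    using assms by (auto simp: young_diagram_iff)
  then show ?thesis by (simp add: column_length_def)
qed

text \<open>Rows of equal length are consecutive; the block for \<open>p\<close> starts just below
  the end of column \<open>Suc p\<close> and stops at the end of column \<open>p\<close>.\<close>

lemma row_length_eq_iff:
  assumes "sorted_wrt (\<ge>) xs" "1 \<le> i" "i \<le> length xs"
  shows "row_length xs i = p \<longleftrightarrow> parts_ge xs (Suc p) < i \<and> i \<le> parts_ge xs p"
  using le_row_length_iff[OF assms, of p] le_row_length_iff[OF assms, of "Suc p"] by linarith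

text \<open>A repeated size \<open>p\<close> yields the last cell of the last but one row of length
  \<open>p\<close>; a size \<open>p\<close> other than 1 yields the last but one cell of the last
  row of length \<open>p\<close>. The maps \<open>?f\<close> and \<open>?g\<close> send
  \<open>p\<close> to these cells.\<close>

lemma card_hook_length_2:
  assumes sorted: "sorted_wrt (\<ge>) xs" and odd: "\<forall>p\<in>set xs. odd p"
  shows "card {c \<in> young_diagram xs. hook_length xs c = 2} =
    card {p. 2 \<le> count (mset xs) p} + card {p. p \<noteq> 1 \<and> 1 \<le> count (mset xs) p}"
    (is "card ?C = card ?A + card ?B")
proof -
  let ?f = "\<lambda>p. (parts_ge xs p - 1, p)" and ?g = "\<lambda>p. (parts_ge xs p, p - 1)"
  have cnt: "count (mset xs) p + parts_ge xs (Suc p) = parts_ge xs p" for p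
    by (rule count_mset_eq_parts_ge)
  have oddp: "odd p" if "1 \<le> count (mset xs) p" for p
    using odd that by (metis count_eq_zero_iff not_one_le_zero set_mset_mset)
  have oddA: "odd p" if "p \<in> ?A" for p
    by (rule oddp, rule order_trans[of _ 2]) (use that in simp_all)
  have oddB: "odd p" if "p \<in> ?B" for p
    using that oddp by blast
  \<comment> \<open>An even number is never a part, so its column and the next one have the same
    length.\<close>
  have even: "parts_ge xs p = parts_ge xs (Suc p)" if "even p" for p
    using cnt[of p] oddp[of p] that by (cases "count (mset xs) p") auto
  have "?C = ?f ` ?A \<union> ?g ` ?B"
  proof (intro equalityI subsetI)
    fix c assume c: "c \<in> ?C"
    obtain i j where [simp]: "c = (i, j)" by (cases c)
    from c have ij: "1 \<le> i" "1 \<le> j" "i \<le> parts_ge xs j"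
      using young_diagram_iff[OF sorted] by auto
    then have il: "i \<le> length xs" using parts_ge_le_length[of xs j] by simp
    define x where "x = row_length xs i"
    have x: "parts_ge xs (Suc x) < i" "i \<le> parts_ge xs x"
      using row_length_eq_iff[OF sorted ij(1) il, of x] x_def by auto
    have "j \<le> x" using c by (auto simp: x_def young_diagram_def)
    moreover have "int x + int (parts_ge xs j) - int i - int j + 1 = 2"
      using c column_length_eq_parts_ge[OF sorted ij(2)] by (simp add: hook_length_def x_def)
    \<comment> \<open>The hook length is arm plus leg plus 1; both are nonnegative, so one of them
      is 1 and the other 0.\<close>
    ultimately consider "x = j" "parts_ge xs j = Suc i" | "x = Suc j" "parts_ge xs j = i"
      using ij(3) by linarith
    then show "c \<in> ?f ` ?A \<union> ?g ` ?B"
    proof cases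
      case 1
      then have "j \<in> ?A" using cnt[of j] x by auto
      moreover have "c = ?f j" using 1 by simp
      ultimately show ?thesis by blast
    next
      case 2
      then have "1 \<le> count (mset xs) x" using cnt[of x] x by linarith
      then have "x \<in> ?B" "even j" using oddp[of x] 2 ij(2) by simp_all
      moreover have "c = ?g x" using 2 even[OF \<open>even j\<close>] by simp
      ultimately show ?thesis by blast
    qed
  next
    fix c assume "c \<in> ?f ` ?A \<union> ?g ` ?B"
    then consider p where "p \<in> ?A" "c = ?f p" | p where "p \<in> ?B" "c = ?g p" by blast
    then show "c \<in> ?C"
    proof cases
      case 1
      then have p: "1 \<le> p" using oddA[of p] by (cases p) auto
      \<comment> \<open>Multiplicity at least 2 keeps the last but one row of column
        \<open>p\<close> inside the block of rows of length \<open>p\<close>.\<close>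
      have bounds: "1 \<le> parts_ge xs p - 1" "parts_ge xs p - 1 \<le> length xs"
        "parts_ge xs (Suc p) < parts_ge xs p - 1"
        using cnt[of p] 1 parts_ge_le_length[of xs p] by auto
      then have "row_length xs (parts_ge xs p - 1) = p"
        using row_length_eq_iff[OF sorted] by simp
      then show ?thesis
        using 1 p bounds column_length_eq_parts_ge[OF sorted p]
        by (simp add: hook_length_def young_diagram_iff[OF sorted])
    next
      case 2
      then have "odd p" "p \<noteq> 1" using oddB by auto
      then have p: "1 \<le> p - 1" "even (p - 1)" "Suc (p - 1) = p" by (auto elim!: oddE)
      \<comment> \<open>Columns \<open>p - 1\<close> and \<open>p\<close> end in the same row, so
        the cell has leg 0.\<close>
      have eq: "parts_ge xs (p - 1) = parts_ge xs p"
        using even[OF p(2)] p(3) by simp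
      have "1 \<le> count (mset xs) p" using 2 by blast
      then have bounds: "1 \<le> parts_ge xs p" "parts_ge xs p \<le> length xs"
        "parts_ge xs (Suc p) < parts_ge xs p"
        using cnt[of p] parts_ge_le_length[of xs p] by linarith+
      then have "row_length xs (parts_ge xs p) = p"
        using row_length_eq_iff[OF sorted] by simp
      then show ?thesis
        using 2 p bounds eq column_length_eq_parts_ge[OF sorted p(1)]
        by (auto simp: hook_length_def young_diagram_iff[OF sorted])
    qed
  qed
  moreover have "?f ` ?A \<inter> ?g ` ?B = {}"
  proof -
    \<comment> \<open>The two kinds of cells are told apart by the parity of the column: odd for
      \<open>?f\<close>, even for \<open>?g\<close>.\<close>
    have False if "p \<in> ?A" "q \<in> ?B" "p = q - 1" for p q
      using oddA[OF that(1)] oddB[OF that(2)] that(3) by (auto elim!: oddE)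
    then show ?thesis by blast
  qed
  moreover have "finite ?A"
  proof (rule finite_subset)
    show "?A \<subseteq> set xs"
      by (metis (no_types, lifting) count_mset_0_iff mem_Collect_eq not_numeral_le_zero subsetI)
  qed simp
  moreover have "finite ?B"
    by (rule finite_subset[of _ "set xs"]) auto
  moreover have "card (?f ` ?A) = card ?A"
    by (rule card_image) (simp add: inj_on_def)
  moreover have "card (?g ` ?B) = card ?B"
  proof (rule card_image, rule inj_onI)
    fix p q assume "p \<in> ?B" "q \<in> ?B" and eq: "?g p = ?g q"
    \<comment> \<open>Positivity makes the truncated \<open>p - 1\<close> injective.\<close>
    then have "0 < p" "0 < q" using oddB odd_pos by blast+
    then show "p = q" using eq by auto
  qed
  ultimately show ?thesis
    by (simp only: card_Un_disjoint finite_imageI)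
qed

subsection \<open>Partitions as multisets\<close>

text \<open>With multisets, adding copies of a part is a plain sum; lists would have to be sorted
  again.\<close>

definition mset_partitions :: "nat set \<Rightarrow> nat \<Rightarrow> nat multiset set" where
  "mset_partitions A n = {M. set_mset M \<subseteq> A \<and> sum_mset M = n}"

lemma finite_mset_partitions:
  assumes "0 \<notin> A"
  shows "finite (mset_partitions A n)"
proof (rule finite_subset)
  show "mset_partitions A n \<subseteq> mset ` {xs. set xs \<subseteq> {..n} \<and> length xs \<le> n}"
  proof
    fix M assume M: "M \<in> mset_partitions A n"
    obtain xs where xs: "M = mset xs" by (metis ex_mset)
    have "length xs \<le> sum_list xs" if "0 \<notin> set xs" for xs :: "nat list"
      using that by (induction xs) auto
    then show "M \<in> mset ` {xs. set xs \<subseteq> {..n} \<and> length xs \<le> n}"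
      using M assms unfolding xs mset_partitions_def
      by (intro imageI) (auto simp: sum_mset_sum_list intro: member_le_sum_list)
  qed
  show "finite (mset ` {xs. set xs \<subseteq> {..n} \<and> length xs \<le> n})"
    by (intro finite_imageI finite_lists_length_le) simp
qed

text \<open>Removing \<open>m\<close> copies of \<open>p\<close> is inverse to adding them, and
  lowers the sum by \<open>m * p\<close>.\<close>

lemma card_mset_partitions_count_ge:
  assumes "p \<in> A"
  shows "card {M \<in> mset_partitions A n. m \<le> count M p} =
    (if m * p \<le> n then card (mset_partitions A (n - m * p)) else 0)"
proof -
  let ?R = "replicate_mset m p"
  \<comment> \<open>The condition is an addition rather than \<open>n - m * p\<close>, so that the
    set is empty when \<open>m * p\<close> exceeds \<open>n\<close>.\<close>
  have eq: "{M \<in> mset_partitions A n. m \<le> count M p} =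
    (\<lambda>M. M + ?R) ` {M. set_mset M \<subseteq> A \<and> sum_mset M + m * p = n}"
  proof (intro equalityI subsetI)
    fix M assume M: "M \<in> {M \<in> mset_partitions A n. m \<le> count M p}"
    then have sub: "?R \<subseteq># M" by (simp add: count_le_replicate_mset_subset_eq)
    then have split: "M = (M - ?R) + ?R" by simp
    have "sum_mset M = sum_mset (M - ?R) + m * p"
      by (subst split) (simp only: sum_mset.union sum_mset_replicate_mset of_nat_id)
    moreover have "set_mset (M - ?R) \<subseteq> A"
      using M by (auto simp: mset_partitions_def dest: in_diffD)
    ultimately show "M \<in> (\<lambda>M. M + ?R) ` {M. set_mset M \<subseteq> A \<and> sum_mset M + m * p = n}"
      using M split by (intro image_eqI[of _ _ "M - ?R"]) (auto simp: mset_partitions_def)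
  qed (use assms in \<open>auto simp: mset_partitions_def split: if_splits\<close>)
  have "card {M \<in> mset_partitions A n. m \<le> count M p} =
    card {M. set_mset M \<subseteq> A \<and> sum_mset M + m * p = n}"
    unfolding eq by (rule card_image) (simp add: inj_on_def)
  also have "{M. set_mset M \<subseteq> A \<and> sum_mset M + m * p = n} =
    (if m * p \<le> n then mset_partitions A (n - m * p) else {})"
    by (auto simp: mset_partitions_def)
  finally show ?thesis by simp
qed

section \<open>Generating functions and Euler's product\<close>

definition partition_gf :: "nat set \<Rightarrow> 'a::comm_ring_1 fps" where
  "partition_gf A = Abs_fps (\<lambda>n. of_nat (card (mset_partitions A n)))"

lemma fps_mset_partitions_count_ge:
  assumes "p \<in> A"
  shows "Abs_fps (\<lambda>n. of_nat (card {M \<in> mset_partitions A n. m \<le> count M p})) =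
    fps_X ^ (m * p) * (partition_gf A :: 'a::comm_ring_1 fps)"
  by (rule fps_ext)
    (auto simp: card_mset_partitions_count_ge[OF assms] fps_X_power_mult_nth partition_gf_def)

text \<open>Partitions without \<open>a\<close> are counted by \<open>partition_gf A\<close>; those
  with \<open>a\<close> lose one copy of it and contribute \<open>fps_X ^ a\<close> times the whole
  series.\<close>

lemma partition_gf_insert:
  assumes "0 \<notin> insert a A" "a \<notin> A"
  shows "(1 - fps_X ^ a) * partition_gf (insert a A) = (partition_gf A :: 'a::comm_ring_1 fps)"
proof -
  have "card (mset_partitions (insert a A) n) = card (mset_partitions A n) +
    card {M \<in> mset_partitions (insert a A) n. 1 \<le> count M a}" for n
  proof -
    have "mset_partitions (insert a A) n =
      mset_partitions A n \<union> {M \<in> mset_partitions (insert a A) n. 1 \<le> count M a}"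
      by (auto simp: mset_partitions_def Suc_le_eq)
    moreover have "mset_partitions A n \<inter>
      {M \<in> mset_partitions (insert a A) n. 1 \<le> count M a} = {}"
      using assms(2) by (auto simp: mset_partitions_def Suc_le_eq)
    ultimately show ?thesis
      using finite_mset_partitions assms(1) by (metis (no_types, lifting) card_Un_disjoint finite_Un)
  qed
  then have "partition_gf (insert a A) = (partition_gf A :: 'a fps) +
    Abs_fps (\<lambda>n. of_nat (card {M \<in> mset_partitions (insert a A) n. 1 \<le> count M a}))"
    by (intro fps_ext) (simp add: partition_gf_def)
  also have "\<dots> = partition_gf A + fps_X ^ (1 * a) * partition_gf (insert a A)"
    by (subst fps_mset_partitions_count_ge) simp_all
  finally show ?thesis by (simp add: algebra_simps)
qed

lemma prod_partition_gf:
  assumes "finite A" "0 \<notin> A"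
  shows "(\<Prod>a\<in>A. 1 - fps_X ^ a) * partition_gf A = (1 :: 'a::comm_ring_1 fps)"
  using assms
proof (induction A rule: finite_induct)
  case empty
  have "mset_partitions {} n = (if n = 0 then {{#}} else {})" for n
    by (auto simp: mset_partitions_def)
  then show ?case by (intro fps_ext) (simp add: partition_gf_def)
next
  case (insert a A)
  then show ?case
    using partition_gf_insert[of a A, where 'a = 'a]
    by (simp add: mult.assoc) (metis mult.left_commute)
qed

subsection \<open>Counting over partitions into odd parts\<close>

definition odds_below :: "nat \<Rightarrow> nat set" where
  "odds_below L = (\<lambda>k. 2 * k + 1) ` {..<L}"

lemma mem_odds_below_iff: "p \<in> odds_below L \<longleftrightarrow> odd p \<and> p \<le> 2 * L - 1"
  by (auto simp: odds_below_def elim!: oddE)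

lemma inj_on_odd: "inj_on (\<lambda>k::nat. 2 * k + 1) A"
  by (simp add: inj_on_def)

text \<open>A multiset has exactly one non-increasing enumeration, the reverse of its ascending
  one.\<close>

lemma bij_betw_mset_odd_partitions:
  "bij_betw mset (odd_partitions L n) (mset_partitions (odds_below L) n)"
proof (rule bij_betwI')
  fix xs ys assume "xs \<in> odd_partitions L n" "ys \<in> odd_partitions L n"
  then have "sorted (rev xs)" "sorted (rev ys)"
    by (auto simp: odd_partitions_def is_partition_def sorted_wrt_rev)
  then show "mset xs = mset ys \<longleftrightarrow> xs = ys"
    by (metis mset_rev properties_for_sort rev_rev_ident)
next
  fix xs assume "xs \<in> odd_partitions L n"
  then show "mset xs \<in> mset_partitions (odds_below L) n"
    by (auto simp: odd_partitions_def is_partition_def mset_partitions_def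
        mem_odds_below_iff sum_mset_sum_list)
next
  fix M assume M: "M \<in> mset_partitions (odds_below L) n"
  let ?xs = "rev (sorted_list_of_multiset M)"
  have "sum_list ?xs = sum_mset M"
    by (metis mset_rev mset_sorted_list_of_multiset sum_mset_sum_list)
  moreover have "sorted_wrt (\<ge>) ?xs"
    by (simp add: sorted_wrt_rev)
  ultimately have "?xs \<in> odd_partitions L n"
    using M by (auto simp: odd_partitions_def is_partition_def mset_partitions_def
        mem_odds_below_iff subset_iff odd_pos)
  then show "\<exists>xs\<in>odd_partitions L n. M = mset xs"
    by (intro bexI[of _ ?xs]) simp_all
qed

text \<open>Double counting of pairs of a partition and a part size with the required
  multiplicity.\<close>

lemma a2_eq_sum_card:
  "a2 L n =
    (\<Sum>p\<in>odds_below L. card {M \<in> mset_partitions (odds_below L) n. 2 \<le> count M p}) +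
    (\<Sum>p\<in>odds_below L - {1}. card {M \<in> mset_partitions (odds_below L) n. 1 \<le> count M p})"
proof -
  let ?O = "odds_below L"
  let ?P = "mset_partitions ?O n"
  have fin: "finite ?P"
    by (rule finite_mset_partitions) (auto simp: odds_below_def)
  have finO: "finite ?O" by (simp add: odds_below_def)
  have swap: "(\<Sum>M\<in>?P. card {p \<in> B. m \<le> count M p}) =
    (\<Sum>p\<in>B. card {M \<in> ?P. m \<le> count M p})" if "B \<subseteq> ?O" for B m
    using sum_multicount_gen[OF fin finite_subset[OF that finO],
        of "\<lambda>M p. m \<le> count M p"] by simp
  have "a2 L n = (\<Sum>xs\<in>odd_partitions L n.
    card {p \<in> ?O. 2 \<le> count (mset xs) p} + card {p \<in> ?O - {1}. 1 \<le> count (mset xs) p})"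
    unfolding a2_def
  proof (rule sum.cong[OF refl])
    fix xs assume xs: "xs \<in> odd_partitions L n"
    \<comment> \<open>Confining \<open>p\<close> to \<open>?O\<close> gives a finite range that does
      not depend on the partition, so that the sums can be exchanged.\<close>
    have in_O: "p \<in> ?O" if "m \<le> count (mset xs) p" "0 < m" for m p
    proof -
      have "0 < count (mset xs) p" using that by linarith
      then show ?thesis
        using xs by (auto simp: odd_partitions_def mem_odds_below_iff)
    qed
    have "{p. 2 \<le> count (mset xs) p} = {p \<in> ?O. 2 \<le> count (mset xs) p}"
      "{p. p \<noteq> 1 \<and> 1 \<le> count (mset xs) p} = {p \<in> ?O - {1}. 1 \<le> count (mset xs) p}"
      using in_O[of 2] in_O[of 1] by auto
    then show "card {c \<in> young_diagram xs. hook_length xs c = 2} =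
      card {p \<in> ?O. 2 \<le> count (mset xs) p} + card {p \<in> ?O - {1}. 1 \<le> count (mset xs) p}"
      using card_hook_length_2[of xs] xs
      by (simp add: odd_partitions_def is_partition_def)
  qed
  also have "\<dots> = (\<Sum>M\<in>?P. card {p \<in> ?O. 2 \<le> count M p} + card {p \<in> ?O - {1}. 1 \<le> count M p})"
    by (rule sum.reindex_bij_betw[OF bij_betw_mset_odd_partitions])
  finally show ?thesis
    by (simp only: sum.distrib swap[OF subset_refl] swap[OF Diff_subset])
qed

lemma fps_a2:
  "Abs_fps (\<lambda>n. of_nat (a2 L n)) = (partition_gf (odds_below L) :: 'a::comm_ring_1 fps) *
    ((\<Sum>p\<in>odds_below L. fps_X ^ (2 * p)) + (\<Sum>p\<in>odds_below L - {1}. fps_X ^ p))"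
proof -
  let ?O = "odds_below L"
  let ?F = "\<lambda>m p. Abs_fps (\<lambda>n. of_nat (card {M \<in> mset_partitions ?O n. m \<le> count M p})) :: 'a fps"
  have "Abs_fps (\<lambda>n. of_nat (a2 L n)) = (\<Sum>p\<in>?O. ?F 2 p) + (\<Sum>p\<in>?O - {1}. ?F 1 p)"
    by (rule fps_ext) (simp add: a2_eq_sum_card fps_sum_nth)
  also have "\<dots> = (\<Sum>p\<in>?O. fps_X ^ (2 * p) * partition_gf ?O) +
      (\<Sum>p\<in>?O - {1}. fps_X ^ (1 * p) * partition_gf ?O)"
    by (intro arg_cong2[where f = "(+)"] sum.cong refl fps_mset_partitions_count_ge) simp_all
  finally show ?thesis
    by (simp add: sum_distrib_left sum_distrib_right algebra_simps)
qed

section \<open>Closed forms of the product and the two sums\<close>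

lemma q_pochhammer_eq_prod_odds:
  "q_pochhammer fps_X (fps_X ^ 2) L = (\<Prod>p\<in>odds_below L. 1 - fps_X ^ p :: 'a::comm_ring_1 fps)"
  unfolding odds_below_def q_pochhammer_def
  by (subst prod.reindex[OF inj_on_odd]) (simp add: power_mult)

lemma fps_geometric_sum:
  assumes "0 < m"
  shows "(\<Sum>k<n. fps_X ^ (m * k)) = (1 - fps_X ^ (m * n)) / (1 - fps_X ^ m :: 'a::field fps)"
proof -
  \<comment> \<open>The constant term is 1 because \<open>m\<close> is positive, so the denominator
    can be cancelled.\<close>
  have "fps_nth (1 - fps_X ^ m :: 'a fps) 0 \<noteq> 0" using assms by simp
  then have "1 - fps_X ^ m \<noteq> (0 :: 'a fps)" by (metis fps_zero_nth)
  moreover have "1 - fps_X ^ (m * n) = (1 - fps_X ^ m :: 'a fps) * (\<Sum>k<n. fps_X ^ (m * k))"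
    by (simp add: power_mult one_diff_power_eq)
  ultimately show ?thesis by simp
qed

text \<open>Splitting off the part 1 makes both sums run over the same parts 3, 5, ...,
  \<open>2 * L - 1\<close>.\<close>

lemma sum_odds_below:
  assumes "L > 0"
  shows "sum f (odds_below L - {1}) = (\<Sum>k<L - 1. f (2 * k + 3))"
    and "sum f (odds_below L) = f 1 + (\<Sum>k<L - 1. f (2 * k + 3))"
proof -
  have fin: "finite (odds_below L)" and one: "1 \<in> odds_below L"
    using assms by (auto simp: odds_below_def)
  have "odds_below L - {1} = (\<lambda>k. 2 * k + 3) ` {..<L - 1}"
  proof -
    have "{..<L} - {0} = Suc ` {..<L - 1}"
      using assms lessThan_Suc_eq_insert_0[of "L - 1"] by auto
    moreover have "odds_below L - {1} = (\<lambda>k. 2 * k + 1) ` ({..<L} - {0})"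
      by (auto simp: odds_below_def)
    ultimately show ?thesis by (simp add: image_image numeral_3_eq_3)
  qed
  then show "sum f (odds_below L - {1}) = (\<Sum>k<L - 1. f (2 * k + 3))"
    by (simp add: sum.reindex inj_on_def)
  then show "sum f (odds_below L) = f 1 + (\<Sum>k<L - 1. f (2 * k + 3))"
    using sum.remove[OF fin one] by metis
qed

theorem theorem2p1:
  fixes L :: nat
  assumes "L > 0"
  defines "q \<equiv> (fps_X :: rat fps)"
  shows "Abs_fps (\<lambda>n. of_nat (a2 L n)) =
    1 / q_pochhammer q (q ^ 2) L *
      (q ^ 2 + q ^ 3 * ((1 - q ^ (2 * L - 2)) / (1 - q ^ 2))
             + q ^ 6 * ((1 - q ^ (4 * L - 4)) / (1 - q ^ 4)))"
proof -
  let ?O = "odds_below L"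
  have gf: "q_pochhammer q (q ^ 2) L * partition_gf ?O = 1"
    unfolding q_def q_pochhammer_eq_prod_odds
    by (rule prod_partition_gf) (auto simp: odds_below_def)
  then have "q_pochhammer q (q ^ 2) L \<noteq> 0" by auto
  with gf have inv: "partition_gf ?O = 1 / q_pochhammer q (q ^ 2) L"
    by (metis nonzero_mult_div_cancel_left)
  have geo: "(\<Sum>k<L - 1. q ^ (2 * k)) = (1 - q ^ (2 * L - 2)) / (1 - q ^ 2)"
    "(\<Sum>k<L - 1. q ^ (4 * k)) = (1 - q ^ (4 * L - 4)) / (1 - q ^ 4)"
    using fps_geometric_sum[of 2 "L - 1", where 'a = rat]
      fps_geometric_sum[of 4 "L - 1", where 'a = rat]
    by (simp_all add: q_def diff_mult_distrib2)
  \<comment> \<open>The part 1 gives \<open>q ^ 2\<close>, and the part \<open>2 * k + 3\<close>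
    gives \<open>q ^ (4 * k + 6)\<close>.\<close>
  have "(\<Sum>p\<in>?O. q ^ (2 * p)) = q ^ 2 + q ^ 6 * (\<Sum>k<L - 1. q ^ (4 * k))"
    by (simp add: sum_odds_below(2)[OF assms(1)] sum_distrib_left algebra_simps power2_eq_square flip: power_add)
  moreover have "(\<Sum>p\<in>?O - {1}. q ^ p) = q ^ 3 * (\<Sum>k<L - 1. q ^ (2 * k))"
    by (simp only: sum_odds_below(1)[OF assms(1)] sum_distrib_left power_add mult.commute)
  ultimately show ?thesis
    unfolding geo using fps_a2[of L, where 'a = rat]
    by (simp only: inv q_def[symmetric] ac_simps)
qed

end
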